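(* Let $X$ be a real Hilbert space, let $m\in\mathbb{N}$, and let $S_1,\dots,S_m\subset X$ be nonempty closed convex sets with $\bigcap_{i=1}^m S_i=\emptyset$. Let $\alpha=(\alpha_1,\dots,\alpha_m)$ with $\alpha_i>0$ for $i=1,\dots,m$ and $\sum_{i=1}^m\alpha_i=1$, and let $$\mathcal{A}(\alpha,p):=\arg\min_{x\in X}\sum_{i=1}^m\alpha_i\, d_{S_i}(x)^p .$$ If either $p>1$ and $m=2$, or $p\ge 2$, then each displacement mapping $I-P_i$, $i=1,\dots,m$, is constant on $\mathcal{A}(\alpha,p)$.
   Context: $d_{S}(x)=\inf_{s\in S}\|x-s\|$ is the distance function to $S$ in the Hilbert norm. $P_i$ denotes the metric projection onto $S_i$ (so $P_i(x)$ is the unique point of $S_i$ with $\|x-P_i(x)\|=d_{S_i}(x)$), and $I$ is the identity mapping on $X$. The set $\mathcal{A}(\alpha,p)$ of global minimizers may be empty. *)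

theory Defs
  imports "HOL-Analysis.Analysis"
begin

text \<open>
  A real Hilbert space is a type of sort \<open>{real_inner, complete_space}\<close>. The distance function
  is the library's \<open>infdist\<close>, which on a nonempty set is the infimum of \<open>dist x s = norm (x - s)\<close>
  over \<open>s \<in> S\<close>.

  The library's \<open>closest_point\<close> requires \<open>heine_borel\<close> (finite dimension in effect), hence the
  following definition. The description denotes a unique point when \<open>S\<close> is nonempty, closed and
  convex; outside that case nothing is claimed about its value.
\<close>

definition metric_proj :: "'a::{real_inner, complete_space} set \<Rightarrow> 'a \<Rightarrow> 'a" where
  "metric_proj S x = (THE s. s \<in> S \<and> norm (x - s) = infdist x S)"

text \<open>
  Sets and weights are indexed by \<open>{1..m}\<close>; values at other indices are irrelevant. The exponent
  is real; \<open>0 powr p = 0\<close> agrees with the usual power for the exponents \<open>p > 0\<close> of interest.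
\<close>

definition weighted_dist_sum ::
    "nat \<Rightarrow> (nat \<Rightarrow> 'a::{real_inner, complete_space} set) \<Rightarrow> (nat \<Rightarrow> real) \<Rightarrow> real \<Rightarrow> 'a \<Rightarrow> real" where
  "weighted_dist_sum m S \<alpha> p x = (\<Sum>i\<in>{1..m}. \<alpha> i * infdist x (S i) powr p)"

definition weighted_minimizers ::
    "nat \<Rightarrow> (nat \<Rightarrow> 'a::{real_inner, complete_space} set) \<Rightarrow> (nat \<Rightarrow> real) \<Rightarrow> real \<Rightarrow> 'a set" where
  "weighted_minimizers m S \<alpha> p = {x. is_arg_min (weighted_dist_sum m S \<alpha> p) (\<lambda>y. y \<in> UNIV) x}"

end

theory Submission
  imports Defs
begin

text \<open>
  Let \<open>x\<close> and \<open>y\<close> be two minimizers, with displacements \<open>u\<^sub>i\<close> and \<open>v\<^sub>i\<close> from their projections onto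
  \<open>S\<^sub>i\<close>. The midpoint of the two projections lies in the convex set \<open>S\<^sub>i\<close>, so the midpoint of \<open>x\<close> and
  \<open>y\<close> is at distance at most \<open>\<parallel>(u\<^sub>i + v\<^sub>i) / 2\<parallel>\<close> from \<open>S\<^sub>i\<close>. For \<open>p > 1\<close> the function \<open>\<parallel>\<cdot>\<parallel>\<^sup>p\<close> is strictly
  midpoint convex on a Hilbert space (\<open>norm_powr_midpoint_less\<close>). If \<open>u\<^sub>i \<noteq> v\<^sub>i\<close> for a single \<open>i\<close>,
  summing over all indices with the positive weights therefore makes the objective at the midpoint
  strictly smaller than the average of its values at \<open>x\<close> and \<open>y\<close>, which is the minimum: a
  contradiction.

  The estimate at the midpoint presupposes that the projections exist. This is the Hilbert
  projection theorem (\<open>projection_ex1\<close>): by the parallelogram law, points of a convex set that are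
  nearly closest to \<open>x\<close> are close to each other, so completeness yields exactly one closest point.
\<close>

section \<open>Strict midpoint convexity of powers of the norm\<close>

text \<open>
  The mean value theorem on the two halves of \<open>[a, b]\<close> compares the derivative \<open>p t\<^sup>p\<^sup>-\<^sup>1\<close> at a point
  left of the midpoint with that at a point right of it, and it is strictly increasing. The
  derivative is only used in the interior, which admits \<open>a = 0\<close>.
\<close>

lemma powr_midpoint_less_ordered:
  fixes a b p :: real
  assumes p: "p > 1" and a: "0 \<le> a" and ab: "a < b"
  shows "((a + b) / 2) powr p < (a powr p + b powr p) / 2"
proof -
  have slope: "\<exists>z>l. z < r \<and> r powr p - l powr p = (r - l) * (p * z powr (p - 1))"
    if "0 \<le> l" "l < r" for l r :: real
  proof -
    have "continuous_on {l..r} (\<lambda>t. t powr p)"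
      using p that by (intro continuous_on_powr' continuous_intros) auto
    moreover have "((\<lambda>t. t powr p) has_derivative (\<lambda>h. h * (p * t powr (p - 1)))) (at t)"
      if "l < t" for t
      using has_real_derivative_powr[of t p] that \<open>0 \<le> l\<close>
      by (simp add: has_field_derivative_def mult_commute_abs)
    ultimately show ?thesis
      using mvt[of l r "\<lambda>t. t powr p" "\<lambda>t h. h * (p * t powr (p - 1))"] \<open>l < r\<close> by auto
  qed
  define c where "c = (a + b) / 2"
  have c: "a < c" "c < b" "b - c = c - a"
    using ab by (auto simp: c_def field_simps)
  obtain s where s: "a < s" "s < c" "c powr p - a powr p = (c - a) * (p * s powr (p - 1))"
    using slope[of a c] a c by auto
  obtain t where t: "c < t" "t < b" "b powr p - c powr p = (b - c) * (p * t powr (p - 1))"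
    using slope[of c b] a c by auto
  have "s powr (p - 1) < t powr (p - 1)"
    using s t a p by (intro powr_less_mono2) auto
  then have "c powr p - a powr p < b powr p - c powr p"
    unfolding s(3) t(3) c(3) using c p by (intro mult_strict_left_mono) auto
  then show ?thesis
    by (simp add: c_def)
qed

lemma powr_midpoint_less:
  fixes a b p :: real
  assumes "p > 1" "0 \<le> a" "0 \<le> b" "a \<noteq> b"
  shows "((a + b) / 2) powr p < (a powr p + b powr p) / 2"
  using powr_midpoint_less_ordered[of p a b] powr_midpoint_less_ordered[of p b a] assms
  by (cases "a < b") (auto simp: add.commute)

lemma parallelogram_law:
  fixes u v :: "'a::real_inner"
  shows "(norm (u + v))\<^sup>2 + (norm (u - v))\<^sup>2 = 2 * (norm u)\<^sup>2 + 2 * (norm v)\<^sup>2"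
  by (simp add: power2_norm_eq_inner inner_simps inner_commute)

text \<open>
  Vectors of different norm are separated by the strict convexity of \<open>t\<^sup>p\<close>, distinct vectors of the
  same norm by the parallelogram law, which puts their midpoint strictly inside the ball.
\<close>

lemma norm_powr_midpoint_less:
  fixes u v :: "'a::real_inner" and p :: real
  assumes p: "p > 1" and uv: "u \<noteq> v"
  shows "norm ((1/2) *\<^sub>R (u + v)) powr p < (norm u powr p + norm v powr p) / 2"
proof (cases "norm u = norm v")
  case True
  have "0 < (norm (u - v))\<^sup>2"
    using uv by simp
  then have "(norm (u + v))\<^sup>2 < 4 * (norm u)\<^sup>2"
    using parallelogram_law[of u v] unfolding True[symmetric] by linarith
  then have "norm (u + v) < 2 * norm u"
    using power2_less_imp_less[of "norm (u + v)" "2 * norm u"] by (simp add: power_mult_distrib)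
  then have "norm ((1/2) *\<^sub>R (u + v)) powr p < norm u powr p"
    using p by (intro powr_less_mono2) simp_all
  then show ?thesis
    using True by simp
next
  case False
  have "norm ((1/2) *\<^sub>R (u + v)) powr p \<le> ((norm u + norm v) / 2) powr p"
    using p norm_triangle_ineq[of u v] by (intro powr_mono2) auto
  also have "\<dots> < (norm u powr p + norm v powr p) / 2"
    using p False by (intro powr_midpoint_less) auto
  finally show ?thesis .
qed

lemma norm_powr_midpoint_le:
  fixes u v :: "'a::real_inner" and p :: real
  assumes "p > 1"
  shows "norm ((1/2) *\<^sub>R (u + v)) powr p \<le> (norm u powr p + norm v powr p) / 2"
proof (cases "u = v")
  case True
  then show ?thesis
    by (simp flip: scaleR_2)
next
  case False
  then show ?thesis
    by (intro less_imp_le norm_powr_midpoint_less assms)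
qed

section \<open>Projection onto closed convex sets\<close>

lemma convex_midpoint_mem:
  assumes "convex S" "s \<in> S" "t \<in> S"
  shows "(1/2) *\<^sub>R (s + t) \<in> S"
  using convexD[OF assms, of "1/2" "1/2"] by (simp add: scaleR_right_distrib)

text \<open>
  The midpoint of \<open>s\<close> and \<open>t\<close> is itself no closer to \<open>x\<close> than the distance to the set, which bounds
  the other diagonal in the parallelogram law.
\<close>

lemma almost_closest_points_near:
  fixes S :: "'a::real_inner set"
  assumes "convex S" "s \<in> S" "t \<in> S" "dist x s \<le> r" "dist x t \<le> r"
  shows "(dist s t)\<^sup>2 \<le> 4 * (r\<^sup>2 - (infdist x S)\<^sup>2)"
proof -
  have sum: "(x - s) + (x - t) = 2 *\<^sub>R (x - (1/2) *\<^sub>R (s + t))"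
    by (simp add: algebra_simps scaleR_2)
  have "infdist x S \<le> norm (x - (1/2) *\<^sub>R (s + t))"
    using infdist_le[OF convex_midpoint_mem[OF assms(1-3)], of x] by (simp add: dist_norm)
  then have "(infdist x S)\<^sup>2 \<le> (norm (x - (1/2) *\<^sub>R (s + t)))\<^sup>2"
    by (intro power_mono infdist_nonneg)
  moreover have "(norm (x - s))\<^sup>2 \<le> r\<^sup>2" "(norm (x - t))\<^sup>2 \<le> r\<^sup>2"
    using assms(4,5) by (auto simp: dist_norm intro: power_mono)
  ultimately show ?thesis
    using parallelogram_law[of "x - s" "x - t"]
    unfolding sum norm_scaleR by (simp add: power_mult_distrib dist_norm norm_minus_commute)
qed

text \<open>
  The closest points are the intersection of the nested nonempty closed sets of points within
  \<open>infdist x S + 1/(n+1)\<close> of \<open>x\<close>. Their diameters tend to zero by the preceding estimate, so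
  completeness makes the intersection a singleton.
\<close>

lemma projection_ex1:
  fixes S :: "'a::{real_inner, complete_space} set"
  assumes "S \<noteq> {}" "closed S" "convex S"
  shows "\<exists>!s. s \<in> S \<and> norm (x - s) = infdist x S"
proof -
  define d where "d = infdist x S"
  define \<delta> where "\<delta> n = inverse (real (Suc n))" for n
  define K where "K n = S \<inter> cball x (d + \<delta> n)" for n
  have \<delta>_lim: "\<delta> \<longlonglongrightarrow> 0"
    unfolding \<delta>_def by (rule LIMSEQ_inverse_real_of_nat)
  have "\<exists>a. \<Inter>(range K) = {a}"
  proof (rule decreasing_closed_nest_sing)
    show "closed (K n)" for n
      using assms by (auto simp: K_def)
    show "K n \<noteq> {}" for n
    proof -
      have "Inf (dist x ` S) < d + \<delta> n"
        using assms by (simp add: d_def \<delta>_def infdist_notempty)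
      then obtain s where "s \<in> S" "dist x s < d + \<delta> n"
        using cInf_lessD[of "dist x ` S"] assms by auto
      then show ?thesis
        by (auto simp: K_def intro: less_imp_le)
    qed
    show "K n \<subseteq> K m" if "m \<le> n" for m n
    proof -
      have "\<delta> n \<le> \<delta> m"
        using that by (simp add: \<delta>_def le_imp_inverse_le)
      then show ?thesis
        by (auto simp: K_def)
    qed
    show "\<exists>n. \<forall>s\<in>K n. \<forall>t\<in>K n. dist s t < \<epsilon>" if "\<epsilon> > 0" for \<epsilon>
    proof -
      have "(\<lambda>n. 4 * ((d + \<delta> n)\<^sup>2 - d\<^sup>2)) \<longlonglongrightarrow> 4 * ((d + 0)\<^sup>2 - d\<^sup>2)"
        by (intro tendsto_intros \<delta>_lim)
      then have "eventually (\<lambda>n. 4 * ((d + \<delta> n)\<^sup>2 - d\<^sup>2) < \<epsilon>\<^sup>2) sequentially"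
        using \<open>\<epsilon> > 0\<close> by (intro order_tendstoD) auto
      then obtain n where n: "4 * ((d + \<delta> n)\<^sup>2 - d\<^sup>2) < \<epsilon>\<^sup>2"
        by (auto simp: eventually_sequentially)
      have "dist s t < \<epsilon>" if "s \<in> K n" "t \<in> K n" for s t
      proof -
        have "(dist s t)\<^sup>2 \<le> 4 * ((d + \<delta> n)\<^sup>2 - d\<^sup>2)"
          using that assms unfolding d_def
          by (intro almost_closest_points_near) (auto simp: K_def d_def)
        with n have "(dist s t)\<^sup>2 < \<epsilon>\<^sup>2"
          by simp
        then show ?thesis
          using \<open>\<epsilon> > 0\<close> by (auto intro: power2_less_imp_less)
      qed
      then show ?thesis
        by blast
    qed
  qed
  then obtain a where a: "\<Inter>(range K) = {a}"
    by blast
  have "s \<in> S \<and> norm (x - s) = d \<longleftrightarrow> s \<in> \<Inter>(range K)" for s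
  proof
    assume "s \<in> S \<and> norm (x - s) = d"
    then show "s \<in> \<Inter>(range K)"
      by (auto simp: K_def \<delta>_def dist_norm)
  next
    assume "s \<in> \<Inter>(range K)"
    then have s: "s \<in> S" "\<And>n. dist x s \<le> d + \<delta> n"
      by (auto simp: K_def)
    have "(\<lambda>n. d + \<delta> n) \<longlonglongrightarrow> d + 0"
      by (intro tendsto_intros \<delta>_lim)
    then have "dist x s \<le> d"
      using s(2) by (intro LIMSEQ_le_const[of "\<lambda>n. d + \<delta> n"]) auto
    then show "s \<in> S \<and> norm (x - s) = d"
      using s(1) infdist_le[OF s(1), of x] by (auto simp: d_def dist_norm)
  qed
  with a show ?thesis
    unfolding d_def by auto
qed

lemma metric_proj:
  fixes S :: "'a::{real_inner, complete_space} set"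
  assumes "S \<noteq> {}" "closed S" "convex S"
  shows "metric_proj S x \<in> S" "norm (x - metric_proj S x) = infdist x S"
  using theI'[OF projection_ex1[OF assms, of x]] unfolding metric_proj_def by auto

lemma infdist_midpoint_le:
  fixes S :: "'a::{real_inner, complete_space} set"
  assumes "S \<noteq> {}" "closed S" "convex S"
  shows "infdist ((1/2) *\<^sub>R (x + y)) S
           \<le> norm ((1/2) *\<^sub>R ((x - metric_proj S x) + (y - metric_proj S y)))"
  using infdist_le[OF convex_midpoint_mem[OF assms(3) metric_proj(1)[OF assms] metric_proj(1)[OF assms]],
      of "(1/2) *\<^sub>R (x + y)" x y]
  by (simp add: dist_norm algebra_simps)

section \<open>The weighted sum at a midpoint\<close>

text \<open>
  Every summand satisfies the weak midpoint inequality and the one with differing displacements the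
  strict one, which survives summation because its weight is positive. Thus a difference in the
  displacements is what turns the convexity of the objective into strict convexity.
\<close>

lemma weighted_dist_sum_midpoint_less:
  fixes S :: "nat \<Rightarrow> 'a::{real_inner, complete_space} set"
  assumes S: "\<And>i. i \<in> {1..m} \<Longrightarrow> S i \<noteq> {}" "\<And>i. i \<in> {1..m} \<Longrightarrow> closed (S i)"
      "\<And>i. i \<in> {1..m} \<Longrightarrow> convex (S i)"
    and \<alpha>: "\<And>i. i \<in> {1..m} \<Longrightarrow> \<alpha> i > 0" and p: "p > 1"
    and j: "j \<in> {1..m}" "x - metric_proj (S j) x \<noteq> y - metric_proj (S j) y"
  shows "weighted_dist_sum m S \<alpha> p ((1/2) *\<^sub>R (x + y))
           < (weighted_dist_sum m S \<alpha> p x + weighted_dist_sum m S \<alpha> p y) / 2"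
proof -
  define u where "u i = x - metric_proj (S i) x" for i
  define v where "v i = y - metric_proj (S i) y" for i
  define z where "z = (1/2) *\<^sub>R (x + y)"
  have norms: "norm (u i) = infdist x (S i)" "norm (v i) = infdist y (S i)" if "i \<in> {1..m}" for i
    using metric_proj(2)[OF S] that by (auto simp: u_def v_def)
  have mid: "infdist z (S i) powr p \<le> norm ((1/2) *\<^sub>R (u i + v i)) powr p" if "i \<in> {1..m}" for i
    using infdist_midpoint_le[OF S, of i x y] that p
    by (intro powr_mono2) (auto simp: u_def v_def z_def infdist_nonneg)
  have le: "infdist z (S i) powr p \<le> (infdist x (S i) powr p + infdist y (S i) powr p) / 2"
    if "i \<in> {1..m}" for i
    using mid[OF that] norm_powr_midpoint_le[OF p, of "u i" "v i"] by (simp add: norms[OF that])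
  have less: "infdist z (S j) powr p < (infdist x (S j) powr p + infdist y (S j) powr p) / 2"
    using mid[OF j(1)] norm_powr_midpoint_less[OF p, of "u j" "v j"] j(2)
    by (simp add: norms[OF j(1)]) (simp add: u_def v_def)
  have "weighted_dist_sum m S \<alpha> p z
      < (\<Sum>i\<in>{1..m}. \<alpha> i * ((infdist x (S i) powr p + infdist y (S i) powr p) / 2))"
    unfolding weighted_dist_sum_def
  proof (rule sum_strict_mono_ex1)
    show "\<forall>i\<in>{1..m}. \<alpha> i * infdist z (S i) powr p
        \<le> \<alpha> i * ((infdist x (S i) powr p + infdist y (S i) powr p) / 2)"
      using le \<alpha> by (auto intro!: mult_left_mono less_imp_le)
    show "\<exists>i\<in>{1..m}. \<alpha> i * infdist z (S i) powr p
        < \<alpha> i * ((infdist x (S i) powr p + infdist y (S i) powr p) / 2)"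
      using less \<alpha> j(1) by (intro bexI[of _ j] mult_strict_left_mono) auto
  qed simp
  also have "\<dots> = (weighted_dist_sum m S \<alpha> p x + weighted_dist_sum m S \<alpha> p y) / 2"
    by (simp add: weighted_dist_sum_def sum.distrib distrib_left add_divide_distrib
        flip: sum_divide_distrib)
  finally show ?thesis
    unfolding z_def .
qed

theorem theorem21:
  fixes S :: "nat \<Rightarrow> 'a::{real_inner, complete_space} set"
    and \<alpha> :: "nat \<Rightarrow> real" and m :: nat and p :: real
  assumes "\<And>i. i \<in> {1..m} \<Longrightarrow> S i \<noteq> {}"
    and "\<And>i. i \<in> {1..m} \<Longrightarrow> closed (S i)"
    and "\<And>i. i \<in> {1..m} \<Longrightarrow> convex (S i)"
    and "(\<Inter>i\<in>{1..m}. S i) = {}"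
    and "\<And>i. i \<in> {1..m} \<Longrightarrow> \<alpha> i > 0"
    and "(\<Sum>i\<in>{1..m}. \<alpha> i) = 1"
    and "(p > 1 \<and> m = 2) \<or> p \<ge> 2"
  shows "\<forall>i\<in>{1..m}. (\<lambda>x. x - metric_proj (S i) x) constant_on weighted_minimizers m S \<alpha> p"
proof
  fix i assume i: "i \<in> {1..m}"
  have p: "p > 1"
    using assms(7) by auto
  have "x - metric_proj (S i) x = y - metric_proj (S i) y"
    if x: "x \<in> weighted_minimizers m S \<alpha> p" and y: "y \<in> weighted_minimizers m S \<alpha> p" for x y
  proof (rule ccontr)
    let ?f = "weighted_dist_sum m S \<alpha> p"
    define z where "z = (1/2) *\<^sub>R (x + y)"
    assume "x - metric_proj (S i) x \<noteq> y - metric_proj (S i) y"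
    then have "?f z < (?f x + ?f y) / 2"
      unfolding z_def using weighted_dist_sum_midpoint_less[of m S \<alpha> p i x y] assms(1-3,5) p i by blast
    moreover have "?f x \<le> ?f z" "?f y \<le> ?f z"
      using x y by (auto simp: weighted_minimizers_def is_arg_min_linorder)
    ultimately show False
      by (simp add: field_simps)
  qed
  then show "(\<lambda>x. x - metric_proj (S i) x) constant_on weighted_minimizers m S \<alpha> p"
    unfolding constant_on_def by blast
qed

end
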